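(* Let $M$ be an ordered $\Gamma$-semigroup. Then $M$ is intra-regular if and only if, for every $x\in M$, $$N(x)=\{y\in M \mid x\in (M\Gamma y\Gamma M]\}.$$
   Context: A $\Gamma$-semigroup consists of nonempty sets $M$ and $\Gamma$ and a well-defined operation $M\times\Gamma\times M\to M$, $(a,\gamma,b)\mapsto a\gamma b$, with $a\gamma(b\mu c)=(a\gamma b)\mu c$ for all $a,b,c\in M$, $\gamma,\mu\in\Gamma$. An ordered $\Gamma$-semigroup ($po$-$\Gamma$-semigroup) is a $\Gamma$-semigroup $M$ with a partial order $\le$ on $M$ such that $a\le b$ implies $a\gamma c\le b\gamma c$ and $c\gamma a\le c\gamma b$ for all $c\in M$, $\gamma\in\Gamma$. Notation: for $A,B\subseteq M$, $A\Gamma B=\{a\gamma b\mid a\in A,\ b\in B,\ \gamma\in\Gamma\}$; singletons are written without braces. Thus $M\Gamma y\Gamma M=\{u\lambda y\mu v\mid u,v\in M,\ \lambda,\mu\in\Gamma\}$ and, for fixed $\gamma\in\Gamma$, $M\Gamma x\gamma x\Gamma M=\{u\lambda (x\gamma x)\mu v\mid u,v\in M,\ \lambda,\mu\in\Gamma\}$. For $H\subseteq M$, $(H]=\{t\in M\mid t\le h\text{ for some }h\in H\}$. $M$ is intra-regular if $x\in (M\Gamma x\gamma x\Gamma M]$ for every $x\in M$ and every $\gamma\in\Gamma$. A subsemigroup of $M$ is a nonempty subset $A\subseteq M$ with $a\gamma b\in A$ for all $a,b\in A$, $\gamma\in\Gamma$. A filter of $M$ is a subsemigroup $F$ of $M$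 such that (1) whenever $a,b\in M$, $\gamma\in\Gamma$ and $a\gamma b\in F$, then $a\in F$ and $b\in F$; and (2) if $a\in F$ and $b\in M$ with $b\ge a$, then $b\in F$. For $x\in M$, $N(x)$ denotes the filter of $M$ generated by $x$, i.e. the least (with respect to inclusion) filter of $M$ containing $x$. *)

theory Defs
  imports Main
begin

locale gamma_semigroup =
  fixes M :: "'a set"
    and \<Gamma> :: "'g set"
    and mul :: "'a \<Rightarrow> 'g \<Rightarrow> 'a \<Rightarrow> 'a"
  assumes M_nonempty: "M \<noteq> {}"
    and \<Gamma>_nonempty: "\<Gamma> \<noteq> {}"
    and mul_closed: "\<lbrakk>a \<in> M; \<gamma> \<in> \<Gamma>; b \<in> M\<rbrakk> \<Longrightarrow> mul a \<gamma> b \<in> M"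
    and mul_assoc: "\<lbrakk>a \<in> M; b \<in> M; c \<in> M; \<gamma> \<in> \<Gamma>; \<mu> \<in> \<Gamma>\<rbrakk> \<Longrightarrow>
      mul a \<gamma> (mul b \<mu> c) = mul (mul a \<gamma> b) \<mu> c"
begin

definition set_mul :: "'a set \<Rightarrow> 'a set \<Rightarrow> 'a set"
  where "set_mul A B = {mul a \<gamma> b | a \<gamma> b. a \<in> A \<and> \<gamma> \<in> \<Gamma> \<and> b \<in> B}"

definition subsemigroup :: "'a set \<Rightarrow> bool"
  where "subsemigroup A \<longleftrightarrow>
    A \<noteq> {} \<and> A \<subseteq> M \<and> (\<forall>a\<in>A. \<forall>b\<in>A. \<forall>\<gamma>\<in>\<Gamma>. mul a \<gamma> b \<in> A)"

end

text \<open>The relation \<open>le\<close> is only constrained on the carrier \<open>M\<close>; every use of it below is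
  restricted to elements of \<open>M\<close>.\<close>

locale po_gamma_semigroup = gamma_semigroup M \<Gamma> mul
  for M :: "'a set"
    and \<Gamma> :: "'g set"
    and mul :: "'a \<Rightarrow> 'g \<Rightarrow> 'a \<Rightarrow> 'a" +
  fixes le :: "'a \<Rightarrow> 'a \<Rightarrow> bool"
  assumes le_refl: "reflp_on M le"
    and le_antisym: "antisymp_on M le"
    and le_trans: "transp_on M le"
    and mul_right_mono: "\<lbrakk>a \<in> M; b \<in> M; c \<in> M; \<gamma> \<in> \<Gamma>; le a b\<rbrakk> \<Longrightarrow> le (mul a \<gamma> c) (mul b \<gamma> c)"
    and mul_left_mono: "\<lbrakk>a \<in> M; b \<in> M; c \<in> M; \<gamma> \<in> \<Gamma>; le a b\<rbrakk> \<Longrightarrow> le (mul c \<gamma> a) (mul c \<gamma> b)"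
begin

definition downset :: "'a set \<Rightarrow> 'a set"
  where "downset H = {t \<in> M. \<exists>h\<in>H. le t h}"

definition intra_regular :: bool
  where "intra_regular \<longleftrightarrow>
    (\<forall>x\<in>M. \<forall>\<gamma>\<in>\<Gamma>. x \<in> downset (set_mul (set_mul M {mul x \<gamma> x}) M))"

definition is_filter :: "'a set \<Rightarrow> bool"
  where "is_filter F \<longleftrightarrow>
    subsemigroup F \<and>
    (\<forall>a\<in>M. \<forall>b\<in>M. \<forall>\<gamma>\<in>\<Gamma>. mul a \<gamma> b \<in> F \<longrightarrow> a \<in> F \<and> b \<in> F) \<and>
    (\<forall>a\<in>F. \<forall>b\<in>M. le a b \<longrightarrow> b \<in> F)"

text \<open>\<open>LEAST\<close> is taken with respect to the order \<open>\<subseteq>\<close> on sets.\<close>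

definition generated_filter :: "'a \<Rightarrow> 'a set"
  where "generated_filter x = (LEAST F. is_filter F \<and> x \<in> F)"

text \<open>For \<open>x \<in> M\<close> the least filter containing \<open>x\<close> exists, so the description above is proper.\<close>

lemma is_filter_carrier: "is_filter M"
  using M_nonempty mul_closed by (auto simp: is_filter_def subsemigroup_def)

lemma is_filter_Inter:
  assumes "\<F> \<noteq> {}" and "\<And>F. F \<in> \<F> \<Longrightarrow> is_filter F" and "\<And>F. F \<in> \<F> \<Longrightarrow> x \<in> F"
  shows "is_filter (\<Inter> \<F>)"
proof -
  have filt: "F \<subseteq> M"
    "\<forall>a\<in>F. \<forall>b\<in>F. \<forall>\<gamma>\<in>\<Gamma>. mul a \<gamma> b \<in> F"
    "\<forall>a\<in>M. \<forall>b\<in>M. \<forall>\<gamma>\<in>\<Gamma>. mul a \<gamma> b \<in> F \<longrightarrow> a \<in> F \<and> b \<in> F"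
    "\<forall>a\<in>F. \<forall>b\<in>M. le a b \<longrightarrow> b \<in> F" if "F \<in> \<F>" for F
    using assms(2)[OF that] unfolding is_filter_def subsemigroup_def by - (elim conjE, assumption)+
  have "\<Inter> \<F> \<noteq> {}"
    using assms(3) by blast
  moreover have "\<Inter> \<F> \<subseteq> M"
    using assms(1) filt(1) by blast
  moreover have "mul a \<gamma> b \<in> \<Inter> \<F>" if "a \<in> \<Inter> \<F>" "b \<in> \<Inter> \<F>" "\<gamma> \<in> \<Gamma>" for a b \<gamma>
    using that by (auto dest: filt(2)[rule_format])
  moreover have "a \<in> \<Inter> \<F> \<and> b \<in> \<Inter> \<F>"
    if "a \<in> M" "b \<in> M" "\<gamma> \<in> \<Gamma>" "mul a \<gamma> b \<in> \<Inter> \<F>" for a b \<gamma>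
    using filt(3)[rule_format, OF _ that(1-3)] that(4) by simp
  moreover have "b \<in> \<Inter> \<F>" if "a \<in> \<Inter> \<F>" "b \<in> M" "le a b" for a b
    using filt(4)[rule_format, OF _ _ that(2,3)] that(1) by simp
  ultimately show ?thesis
    unfolding is_filter_def subsemigroup_def by (intro conjI ballI impI) (assumption | metis)+
qed

lemma
  assumes "x \<in> M"
  shows is_filter_generated_filter: "is_filter (generated_filter x)"
    and generated_filter_contains: "x \<in> generated_filter x"
    and generated_filter_least: "\<And>F. \<lbrakk>is_filter F; x \<in> F\<rbrakk> \<Longrightarrow> generated_filter x \<subseteq> F"
proof -
  let ?\<F> = "{F. is_filter F \<and> x \<in> F}"
  have filt: "is_filter (\<Inter> ?\<F>)"
  proof (rule is_filter_Inter[where x = x])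
    show "?\<F> \<noteq> {}"
      using is_filter_carrier assms by auto
  qed simp_all
  have eq: "generated_filter x = \<Inter> ?\<F>"
    unfolding generated_filter_def
  proof (rule Least_equality)
    show "is_filter (\<Inter> ?\<F>) \<and> x \<in> \<Inter> ?\<F>"
      using filt by simp
    show "\<Inter> ?\<F> \<le> F" if "is_filter F \<and> x \<in> F" for F
      using that by (intro Inter_lower) simp
  qed
  show "is_filter (generated_filter x)"
    unfolding eq by (rule filt)
  show "x \<in> generated_filter x"
    unfolding eq by simp
  show "generated_filter x \<subseteq> F" if "is_filter F" "x \<in> F" for F
    unfolding eq using that by (intro Inter_lower) simp
qed

end

end

theory Submission
  imports Defs
begin

text \<open>The divisors of \<open>x\<close> in the sense \<open>x \<in> (M\<Gamma>y\<Gamma>M]\<close> always lie in every filter containing \<open>x\<close>.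
  If \<open>M\<close> is intra-regular, they are closed under products: given \<open>x \<le> uav\<close> and \<open>x \<le> pbq\<close>, from
  \<open>x \<in> (M\<Gamma>xx\<Gamma>M]\<close> and \<open>xx \<le> (pbq)(uav)\<close> the element \<open>w = bqua\<close> divides \<open>x\<close>, and
  \<open>w \<in> (M\<Gamma>w\<gamma>w\<Gamma>M]\<close> shows that the factor \<open>a\<gamma>b\<close> of \<open>w\<gamma>w\<close> divides \<open>w\<close>.
  Conversely, \<open>x\<gamma>x \<in> N(x)\<close> is intra-regularity at \<open>x\<close>.\<close>

context po_gamma_semigroup
begin

text \<open>Divisibility up to the order: \<open>x \<in> multiples y\<close> reads as
  \<open>y\<close> divides \<open>x\<close>. A cofactor is required on both sides, so reflexivity is
  not automatic.\<close>

abbreviation multiples :: "'a \<Rightarrow> 'a set"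
  where "multiples y \<equiv> downset (set_mul (set_mul M {y}) M)"

lemma multiplesI:
  assumes "x \<in> M" "u \<in> M" "\<nu> \<in> \<Gamma>" "\<mu> \<in> \<Gamma>" "v \<in> M" "le x (mul (mul u \<nu> y) \<mu> v)"
  shows "x \<in> multiples y"
  using assms unfolding downset_def set_mul_def by blast

lemma multiplesE:
  assumes "x \<in> multiples y"
  obtains u \<nu> \<mu> v where "x \<in> M" "u \<in> M" "\<nu> \<in> \<Gamma>" "\<mu> \<in> \<Gamma>" "v \<in> M"
    "le x (mul (mul u \<nu> y) \<mu> v)"
  using assms unfolding downset_def set_mul_def by blast

lemma le_transD: "\<lbrakk>le a b; le b c; a \<in> M; b \<in> M; c \<in> M\<rbrakk> \<Longrightarrow> le a c"
  using le_trans by (blast dest: transp_onD)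

lemma mul_mono:
  assumes "a \<in> M" "b \<in> M" "c \<in> M" "d \<in> M" "\<gamma> \<in> \<Gamma>" "le a b" "le c d"
  shows "le (mul a \<gamma> c) (mul b \<gamma> d)"
proof (rule le_transD)
  show "le (mul a \<gamma> c) (mul b \<gamma> c)"
    using assms by (intro mul_right_mono)
  show "le (mul b \<gamma> c) (mul b \<gamma> d)"
    using assms by (intro mul_left_mono)
qed (use assms in \<open>simp_all add: mul_closed\<close>)

lemma multiples_mono:
  assumes "y \<in> M" "z \<in> M" "le y z"
  shows "multiples y \<subseteq> multiples z"
proof
  fix x assume "x \<in> multiples y"
  then obtain u \<nu> \<mu> v where x: "x \<in> M" "u \<in> M" "\<nu> \<in> \<Gamma>" "\<mu> \<in> \<Gamma>" "v \<in> M"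
    "le x (mul (mul u \<nu> y) \<mu> v)"
    by (rule multiplesE)
  moreover have "le (mul (mul u \<nu> y) \<mu> v) (mul (mul u \<nu> z) \<mu> v)"
    using x assms by (intro mul_right_mono mul_left_mono mul_closed)
  ultimately have "le x (mul (mul u \<nu> z) \<mu> v)"
    using assms by - (erule (1) le_transD, simp_all add: mul_closed)
  then show "x \<in> multiples z"
    using x by (intro multiplesI)
qed

text \<open>Reassociation absorbs \<open>b\<close> into the right cofactor. With its mirror image
  below, this makes every factor of a divisor a divisor.\<close>

lemma multiples_mul_left:
  assumes "a \<in> M" "b \<in> M" "\<gamma> \<in> \<Gamma>"
  shows "multiples (mul a \<gamma> b) \<subseteq> multiples a"
proof
  fix x assume "x \<in> multiples (mul a \<gamma> b)"
  then obtain u \<nu> \<mu> v where x: "x \<in> M" "u \<in> M" "\<nu> \<in> \<Gamma>" "\<mu> \<in> \<Gamma>" "v \<in> M"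
    "le x (mul (mul u \<nu> (mul a \<gamma> b)) \<mu> v)"
    by (rule multiplesE)
  moreover have "mul (mul u \<nu> (mul a \<gamma> b)) \<mu> v = mul (mul u \<nu> a) \<gamma> (mul b \<mu> v)"
    using x assms by (simp add: mul_assoc mul_closed)
  ultimately show "x \<in> multiples a"
    using assms by (intro multiplesI[of x u \<nu> \<gamma> "mul b \<mu> v"]) (simp_all add: mul_closed)
qed

lemma multiples_mul_right:
  assumes "a \<in> M" "b \<in> M" "\<gamma> \<in> \<Gamma>"
  shows "multiples (mul a \<gamma> b) \<subseteq> multiples b"
proof
  fix x assume "x \<in> multiples (mul a \<gamma> b)"
  then obtain u \<nu> \<mu> v where x: "x \<in> M" "u \<in> M" "\<nu> \<in> \<Gamma>" "\<mu> \<in> \<Gamma>" "v \<in> M"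
    "le x (mul (mul u \<nu> (mul a \<gamma> b)) \<mu> v)"
    by (rule multiplesE)
  moreover have "mul (mul u \<nu> (mul a \<gamma> b)) \<mu> v = mul (mul (mul u \<nu> a) \<gamma> b) \<mu> v"
    using x assms by (simp add: mul_assoc mul_closed)
  ultimately show "x \<in> multiples b"
    using assms by (intro multiplesI[of x "mul u \<nu> a" \<gamma> \<mu> v]) (simp_all add: mul_closed)
qed

text \<open>Monotonicity replaces \<open>w\<close> by the product bounding it, and the two
  absorption lemmas then strip the outer factors \<open>v\<close> and \<open>u\<close>.\<close>

lemma multiples_trans:
  assumes "x \<in> multiples w" "w \<in> multiples y" "y \<in> M"
  shows "x \<in> multiples y"
proof -
  from assms(2) obtain u \<nu> \<mu> v where w: "w \<in> M" "u \<in> M" "\<nu> \<in> \<Gamma>" "\<mu> \<in> \<Gamma>" "v \<in> M"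
    "le w (mul (mul u \<nu> y) \<mu> v)"
    by (rule multiplesE)
  then have "x \<in> multiples (mul (mul u \<nu> y) \<mu> v)"
    using assms(1,3) multiples_mono[of w "mul (mul u \<nu> y) \<mu> v"] by (auto simp: mul_closed)
  then have "x \<in> multiples (mul u \<nu> y)"
    using w assms(3) multiples_mul_left[of "mul u \<nu> y" v \<mu>] by (auto simp: mul_closed)
  then show ?thesis
    using w assms(3) multiples_mul_right[of u y \<nu>] by auto
qed

lemma intra_regularD:
  "\<lbrakk>intra_regular; x \<in> M; \<gamma> \<in> \<Gamma>\<rbrakk> \<Longrightarrow> x \<in> multiples (mul x \<gamma> x)"
  unfolding intra_regular_def by blast

lemma intra_regular_multiples_mul:
  assumes ir: "intra_regular" and M: "a \<in> M" "b \<in> M" and \<gamma>: "\<gamma> \<in> \<Gamma>"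
    and xa: "x \<in> multiples a" and xb: "x \<in> multiples b"
  shows "x \<in> multiples (mul a \<gamma> b)"
proof -
  obtain u \<alpha> \<beta> v where a: "x \<in> M" "u \<in> M" "\<alpha> \<in> \<Gamma>" "\<beta> \<in> \<Gamma>" "v \<in> M"
    "le x (mul (mul u \<alpha> a) \<beta> v)"
    using xa by (rule multiplesE)
  obtain p \<delta> \<epsilon> q where b: "p \<in> M" "\<delta> \<in> \<Gamma>" "\<epsilon> \<in> \<Gamma>" "q \<in> M"
    "le x (mul (mul p \<delta> b) \<epsilon> q)"
    using xb by (rule multiplesE)
  \<comment> \<open>The middle of the product (pbq)(uav). The bound through \<open>b\<close> is
    taken as the left factor so that \<open>w\<close> starts with \<open>b\<close> and ends with
    \<open>a\<close>.\<close>
  define w where "w = mul (mul b \<epsilon> (mul q \<gamma> u)) \<alpha> a"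
  have w: "w \<in> M"
    unfolding w_def using M \<gamma> a b by (simp add: mul_closed)
  have "le (mul x \<gamma> x) (mul (mul (mul p \<delta> b) \<epsilon> q) \<gamma> (mul (mul u \<alpha> a) \<beta> v))"
    using M \<gamma> a b by (intro mul_mono mul_closed)
  moreover have "mul (mul (mul p \<delta> b) \<epsilon> q) \<gamma> (mul (mul u \<alpha> a) \<beta> v) = mul (mul p \<delta> w) \<beta> v"
    unfolding w_def using M \<gamma> a b by (simp add: mul_assoc mul_closed)
  ultimately have "mul x \<gamma> x \<in> multiples w"
    using M \<gamma> a b by (intro multiplesI[of _ p \<delta> \<beta> v]) (simp_all add: mul_closed)
  then have "x \<in> multiples w"
    using multiples_trans[OF intra_regularD[OF ir a(1) \<gamma>] _ w] by blast
  moreover have "w \<in> multiples (mul a \<gamma> b)"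
  proof -
    let ?c = "mul b \<epsilon> (mul q \<gamma> u)" and ?d = "mul (mul q \<gamma> u) \<alpha> a"
    \<comment> \<open>Where the two copies of \<open>w\<close> meet, the final \<open>a\<close> of
      the first and the initial \<open>b\<close> of the second form exactly
      \<open>mul a \<gamma> b\<close>.\<close>
    have "mul w \<gamma> w = mul (mul ?c \<alpha> (mul a \<gamma> b)) \<epsilon> ?d"
      unfolding w_def using M \<gamma> a b by (simp add: mul_assoc mul_closed)
    moreover have "?c \<in> M" "?d \<in> M" "mul a \<gamma> b \<in> M"
      using M \<gamma> a b by (simp_all add: mul_closed)
    ultimately show ?thesis
      using intra_regularD[OF ir w \<gamma>] a b
        multiples_mul_left[of "mul ?c \<alpha> (mul a \<gamma> b)" ?d \<epsilon>]
        multiples_mul_right[of ?c "mul a \<gamma> b" \<alpha>]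
      by (auto simp: mul_closed)
  qed
  ultimately show ?thesis
    using multiples_trans M \<gamma> by (simp add: mul_closed)
qed

text \<open>Upward closure puts the product bounding \<open>x\<close> into \<open>F\<close>; the
  factor condition, applied twice, removes first \<open>v\<close> and then \<open>u\<close>.\<close>

lemma divisors_subset_filter:
  assumes F: "is_filter F" and "x \<in> F" "y \<in> M" "x \<in> multiples y"
  shows "y \<in> F"
proof -
  obtain u \<alpha> \<beta> v where x: "x \<in> M" "u \<in> M" "\<alpha> \<in> \<Gamma>" "\<beta> \<in> \<Gamma>" "v \<in> M"
    "le x (mul (mul u \<alpha> y) \<beta> v)"
    using assms(4) by (rule multiplesE)
  have uy: "mul u \<alpha> y \<in> M"
    using x assms(3) mul_closed by blast
  then have "mul (mul u \<alpha> y) \<beta> v \<in> F"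
    using F x assms(2) mul_closed unfolding is_filter_def by blast
  then have "mul u \<alpha> y \<in> F"
    using F x uy unfolding is_filter_def by blast
  then show ?thesis
    using F x assms(3) unfolding is_filter_def by blast
qed

text \<open>\<open>x\<close> divides itself because it is a factor of its divisor
  \<open>mul x \<gamma> x\<close>, for any chosen \<open>\<gamma>\<close>.\<close>

lemma intra_regular_divisor:
  assumes "intra_regular" "x \<in> M"
  shows "x \<in> multiples x"
proof -
  obtain \<gamma> where "\<gamma> \<in> \<Gamma>"
    using \<Gamma>_nonempty by blast
  then show ?thesis
    using intra_regularD[OF assms] multiples_mul_left[OF assms(2,2)] by blast
qed

text \<open>Intra-regularity enters through nonemptiness, witnessed by \<open>x\<close>, and closure
  under products. The factor condition and upward closure are the inclusions between sets of
  multiples.\<close>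

lemma intra_regular_is_filter_divisors:
  assumes "intra_regular" "x \<in> M"
  shows "is_filter {y \<in> M. x \<in> multiples y}"
proof -
  have "subsemigroup {y \<in> M. x \<in> multiples y}"
    unfolding subsemigroup_def
    using intra_regular_divisor[OF assms] assms mul_closed intra_regular_multiples_mul by blast
  then show ?thesis
    unfolding is_filter_def
    using multiples_mul_left multiples_mul_right multiples_mono by blast
qed

lemma intra_regular_generated_filter:
  assumes "intra_regular" "x \<in> M"
  shows "generated_filter x = {y \<in> M. x \<in> multiples y}"
proof
  show "generated_filter x \<subseteq> {y \<in> M. x \<in> multiples y}"
    using generated_filter_least intra_regular_is_filter_divisors intra_regular_divisor assms
    by simp
  show "{y \<in> M. x \<in> multiples y} \<subseteq> generated_filter x"
    using divisors_subset_filter is_filter_generated_filter generated_filter_contains assms(2)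
    by blast
qed

lemma intra_regular_iff_generated_filter:
  "intra_regular \<longleftrightarrow> (\<forall>x\<in>M. generated_filter x = {y \<in> M. x \<in> multiples y})"
proof
  assume "\<forall>x\<in>M. generated_filter x = {y \<in> M. x \<in> multiples y}"
  \<comment> \<open>A filter is closed under products; by the assumed description, this membership
    says that \<open>mul x \<gamma> x\<close> divides \<open>x\<close>.\<close>
  moreover have "mul x \<gamma> x \<in> generated_filter x" if "x \<in> M" "\<gamma> \<in> \<Gamma>" for x \<gamma>
    using is_filter_generated_filter[OF that(1)] generated_filter_contains[OF that(1)] that(2)
    unfolding is_filter_def subsemigroup_def by blast
  ultimately show intra_regular
    unfolding intra_regular_def by blast
qed (blast dest: intra_regular_generated_filter)

end

theorem theorem2:
  fixes M :: "'a set"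
    and \<Gamma> :: "'g set"
    and mul :: "'a \<Rightarrow> 'g \<Rightarrow> 'a \<Rightarrow> 'a"
    and le :: "'a \<Rightarrow> 'a \<Rightarrow> bool"
  assumes "po_gamma_semigroup M \<Gamma> mul le"
  shows "po_gamma_semigroup.intra_regular M \<Gamma> mul le \<longleftrightarrow>
    (\<forall>x\<in>M. po_gamma_semigroup.generated_filter M \<Gamma> mul le x =
      {y \<in> M. x \<in> po_gamma_semigroup.downset M le
        (gamma_semigroup.set_mul \<Gamma> mul (gamma_semigroup.set_mul \<Gamma> mul M {y}) M)})"
  using assms by (rule po_gamma_semigroup.intra_regular_iff_generated_filter)

end
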